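(* Let $k\ge 4$ be an integer. The following two statements are equivalent: (a) for every integer $n\ge 1$ and every cube-ideal set $S\subseteq\{0,1\}^n$, either all the points in $S$ agree on a coordinate, or there is a subset of at most $k$ points of $S$ that do not agree on a coordinate; (b) every $k$-wise intersecting clutter is non-ideal (i.e. not ideal).
   Context: Let $V$ be a finite set of elements. A family $\mathcal{C}$ of subsets of $V$ (called members) is a clutter over ground set $V$ if no member contains another one. $\mathcal{C}$ is ideal if for every $w\in\mathbb{Z}^V_+$ the linear program $\min\{w^\top x : \sum_{u\in C}x_u\ge 1\ \forall C\in\mathcal{C},\ x\ge \mathbf{0}\}$ has an integral optimal solution. $\mathcal{C}$ is $k$-wise intersecting if every subset of at most $k$ members have a common element (in $V$), yet no element of $V$ belongs to all members. The points in $S\subseteq\{0,1\}^n$ agree on a coordinate if $S\subseteq\{x : x_i=a\}$ for some $i\in[n]=\{1,\dots,n\}$ and some $a\in\{0,1\}$. A generalized set covering inequality is an inequality of the form $\sum_{i\in I}x_i+\sum_{j\in J}(1-x_j)\ge 1$ for some disjoint $I,J\subseteq[n]$. The set $S\subseteq\{0,1\}^n$ is cube-ideal if its convex hull $\mathrm{conv}(S)$ is the solution set of a system of inequalities each of which is of the form $x_i\ge 0$, $x_i\le 1$, or a generalized set covering inequality. *)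

theory Defs
  imports Complex_Main "HOL-Analysis.Convex" "HOL-Library.Function_Algebras"
    "HOL-Library.Infinite_Typeclass"
begin

definition clutter :: "'v set \<Rightarrow> 'v set set \<Rightarrow> bool" where
  "clutter V \<C> \<longleftrightarrow>
     finite V \<and> (\<forall>A\<in>\<C>. A \<subseteq> V) \<and> (\<forall>A\<in>\<C>. \<forall>B\<in>\<C>. A \<subseteq> B \<longrightarrow> A = B)"

text \<open>Only the values of a vector on the ground set \<open>V\<close> are relevant below.\<close>

definition cover_feasible :: "'v set \<Rightarrow> 'v set set \<Rightarrow> ('v \<Rightarrow> real) \<Rightarrow> bool" where
  "cover_feasible V \<C> x \<longleftrightarrow> (\<forall>A\<in>\<C>. (\<Sum>u\<in>A. x u) \<ge> 1) \<and> (\<forall>u\<in>V. x u \<ge> 0)"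

definition ideal_clutter :: "'v set \<Rightarrow> 'v set set \<Rightarrow> bool" where
  "ideal_clutter V \<C> \<longleftrightarrow>
     (\<forall>w :: 'v \<Rightarrow> int. (\<forall>u\<in>V. w u \<ge> 0) \<longrightarrow>
       (\<exists>x. cover_feasible V \<C> x \<and> (\<forall>u\<in>V. x u \<in> \<int>) \<and>
            (\<forall>y. cover_feasible V \<C> y \<longrightarrow>
               (\<Sum>u\<in>V. of_int (w u) * x u) \<le> (\<Sum>u\<in>V. of_int (w u) * y u))))"

text \<open>The empty subset of \<open>\<C>\<close> is included: every element of \<open>V\<close> is common to its members.\<close>

definition k_wise_intersecting :: "nat \<Rightarrow> 'v set \<Rightarrow> 'v set set \<Rightarrow> bool" where
  "k_wise_intersecting k V \<C> \<longleftrightarrow>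
     (\<forall>\<D>\<subseteq>\<C>. finite \<D> \<and> card \<D> \<le> k \<longrightarrow> (\<exists>v\<in>V. \<forall>A\<in>\<D>. v \<in> A)) \<and>
     \<not> (\<exists>v\<in>V. \<forall>A\<in>\<C>. v \<in> A)"

text \<open>The pointwise vector space structure on functions, so that the library's \<open>convex hull\<close>
  applies to vectors of type \<open>nat \<Rightarrow> real\<close>.\<close>

instantiation "fun" :: (type, real_vector) real_vector
begin

definition scaleR_fun :: "real \<Rightarrow> ('a \<Rightarrow> 'b) \<Rightarrow> 'a \<Rightarrow> 'b" where
  "scaleR_fun r f = (\<lambda>x. r *\<^sub>R f x)"

instance
  by standard (simp_all add: scaleR_fun_def fun_eq_iff scaleR_add_right scaleR_add_left)

end

text \<open>Since \<open>n\<close> has to vary inside a formula, real \<open>n\<close>-space is the set of functions on the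
  naturals that vanish outside the index set \<open>{1..n}\<close>.\<close>

definition real_space :: "nat \<Rightarrow> (nat \<Rightarrow> real) set" where
  "real_space n = {x. \<forall>i. i \<notin> {1..n} \<longrightarrow> x i = 0}"

definition cube :: "nat \<Rightarrow> (nat \<Rightarrow> real) set" where
  "cube n = {x \<in> real_space n. \<forall>i\<in>{1..n}. x i \<in> {0, 1}}"

definition agree_on_coordinate :: "nat \<Rightarrow> (nat \<Rightarrow> real) set \<Rightarrow> bool" where
  "agree_on_coordinate n S \<longleftrightarrow> (\<exists>i\<in>{1..n}. \<exists>a\<in>{0, 1}. S \<subseteq> {x. x i = a})"

datatype cube_ineq =
    Lower nat
  | Upper nat
  | Gen_Cover "nat set" "nat set"

fun ineq_in_dim :: "nat \<Rightarrow> cube_ineq \<Rightarrow> bool" where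
  "ineq_in_dim n (Lower i) \<longleftrightarrow> i \<in> {1..n}"
| "ineq_in_dim n (Upper i) \<longleftrightarrow> i \<in> {1..n}"
| "ineq_in_dim n (Gen_Cover I J) \<longleftrightarrow> I \<subseteq> {1..n} \<and> J \<subseteq> {1..n} \<and> I \<inter> J = {}"

fun satisfies :: "(nat \<Rightarrow> real) \<Rightarrow> cube_ineq \<Rightarrow> bool" where
  "satisfies x (Lower i) \<longleftrightarrow> x i \<ge> 0"
| "satisfies x (Upper i) \<longleftrightarrow> x i \<le> 1"
| "satisfies x (Gen_Cover I J) \<longleftrightarrow> (\<Sum>i\<in>I. x i) + (\<Sum>j\<in>J. 1 - x j) \<ge> 1"

text \<open>The system \<open>Q\<close> below is automatically finite, as only finitely many inequalities satisfy
  \<open>ineq_in_dim n\<close>.\<close>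

definition cube_ideal :: "nat \<Rightarrow> (nat \<Rightarrow> real) set \<Rightarrow> bool" where
  "cube_ideal n S \<longleftrightarrow>
     S \<subseteq> cube n \<and>
     (\<exists>Q. (\<forall>q\<in>Q. ineq_in_dim n q) \<and>
          convex hull S = {x \<in> real_space n. \<forall>q\<in>Q. satisfies x q})"

end

theory Submission
  imports Defs "HOL-Analysis.Function_Topology"
begin

text \<open>
  The bridge between the two statements is the correspondence between 0/1 points and transversals.

  If \<open>S\<close> is cube-ideal, replace each coordinate \<open>i\<close> by two elements, one for \<open>x\<^sub>i = 1\<close> and one for
  \<open>x\<^sub>i = 0\<close>, and each point by the set of the \<open>n\<close> elements that it selects. In the resulting clutter,
  the cuboid of \<open>S\<close>, a common element is the same thing as a coordinate on which the points agree.
  The cuboid is ideal (\<open>cuboid_ideal\<close>): given weights, scale them so that every cover weighs at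
  least one and lower them until each positive weight lies in a cover of weight exactly one. The
  weights of the two elements of a coordinate then sum to one (\<open>tight_weights_complementary\<close>), so
  they are a point of the cube, and this point satisfies the system that defines the convex hull of
  \<open>S\<close>. Being a convex combination of members, the weights pair to at least one with every
  fractional solution. A counterexample to the statement on cube-ideal sets therefore yields an
  ideal \<open>k\<close>-wise intersecting clutter.

  Conversely, let an ideal \<open>k\<close>-wise intersecting clutter be given. Delete elements as long as no
  element is common to all remaining members. In the end every element \<open>u\<close> has a partner \<open>v\<close> such that
  \<open>{u, v}\<close> meets every member (\<open>deletion_with_two_covers\<close>). Keep only the members that contain exactly
  one element of each two-element cover; they form the core. By Lehman's theorem that the
  blocker of an ideal clutter is ideal (\<open>ideal_blocker_dominates_members\<close>), the convex hull of the
  incidence vectors of the core is described by the inequalities \<open>x \<ge> 0\<close>, \<open>x(B) \<ge> 1\<close> for covers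
  \<open>B\<close>, and \<open>x\<^sub>u + x\<^sub>v \<le> 1\<close> for two-element covers \<open>{u, v}\<close>. The last of these is
  \<open>(1 - x\<^sub>u) + (1 - x\<^sub>v) \<ge> 1\<close>, so all are generalized set covering inequalities or bounds and the core
  is a cube-ideal set (\<open>core_cube_ideal\<close>). The constant vector with entries one half satisfies the
  system, hence is a convex combination of the core, and so the points of the core agree on no
  coordinate. At most \<open>k\<close> of them still agree on one, because the corresponding members intersect.
\<close>

section \<open>A theorem of the alternative\<close>

text \<open>
  This is the form of linear programming duality behind Lehman's theorem. Among all points of the
  simplex over \<open>F\<close> take one whose combination of the rows of \<open>M\<close> exceeds \<open>w\<close> by as little as possible
  in the Euclidean sense. If the excess \<open>c\<close> is not zero, it is the required separating vector, by the
  first-order optimality condition in the direction of each vertex of the simplex.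
\<close>

lemma domination_or_separation:
  fixes M :: "'b \<Rightarrow> 'v \<Rightarrow> real" and w :: "'v \<Rightarrow> real"
  assumes F: "finite F" and V: "finite V"
  shows "(\<exists>l. (\<forall>b\<in>F. 0 \<le> l b) \<and> sum l F = 1 \<and> (\<forall>v\<in>V. (\<Sum>b\<in>F. l b * M b v) \<le> w v)) \<or>
         (\<exists>c. (\<forall>v\<in>V. 0 \<le> c v) \<and> (\<forall>b\<in>F. (\<Sum>v\<in>V. c v * w v) < (\<Sum>v\<in>V. c v * M b v)))"
proof (cases "F = {}")
  case True
  then show ?thesis by (intro disjI2 exI[of _ "\<lambda>_. 0"]) simp
next
  case False
  then obtain b\<^sub>0 where b\<^sub>0: "b\<^sub>0 \<in> F" by auto
  define p where "p = (\<lambda>l v. \<Sum>b\<in>F. l b * M b v)"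
  define g where "g = (\<lambda>l. \<Sum>v\<in>V. (max 0 (p l v - w v))\<^sup>2)"
  define K where "K = PiE UNIV (\<lambda>_. {0..1::real}) \<inter> {l :: 'b \<Rightarrow> real. sum l F = 1}"
  have cube: "compact (PiE UNIV (\<lambda>_::'b. {0..1::real}))"
    using compactin_PiE[of "\<lambda>_::'b. euclidean" UNIV "\<lambda>_. {0..1::real}"]
    by (simp add: euclidean_product_topology compactin_euclidean_iff)
  have "compact K"
    unfolding K_def using F
    by (intro compact_Int_closed cube closed_Collect_eq continuous_intros)
      (auto intro!: continuous_intros)
  moreover have "(\<lambda>b. of_bool (b = b\<^sub>0)) \<in> K"
    using F b\<^sub>0 by (auto simp: K_def of_bool_def sum.delta)
  moreover have "continuous_on K g"
    unfolding g_def p_def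
    by (intro continuous_intros continuous_on_max)
      (auto intro: continuous_on_subset[OF continuous_on_product_coordinates])
  ultimately obtain l where l: "l \<in> K" and min: "\<And>l'. l' \<in> K \<Longrightarrow> g l \<le> g l'"
    using continuous_attains_inf[of K g] by blast
  have l0: "0 \<le> l b" and l1: "l b \<le> 1" for b using l by (auto simp: K_def PiE_iff)
  have lsum: "sum l F = 1" using l by (auto simp: K_def)
  define c where "c = (\<lambda>v. max 0 (p l v - w v))"
  have c0: "0 \<le> c v" for v by (simp add: c_def)
  show ?thesis
  proof (cases "\<forall>v\<in>V. c v = 0")
    case True
    then have "p l v \<le> w v" if "v \<in> V" for v using that unfolding c_def by (smt (verit))
    then show ?thesis using l0 lsum unfolding p_def by blast
  next
    case False
    then have pos: "0 < (\<Sum>v\<in>V. (c v)\<^sup>2)"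
      by (meson V sum_pos2 zero_le_power2 zero_less_power2)
    have "(\<Sum>v\<in>V. c v * w v) < (\<Sum>v\<in>V. c v * M b v)" if b: "b \<in> F" for b
    proof -
      define d where "d = (\<lambda>v. M b v - p l v)"
      \<comment> \<open>Moving from \<open>l\<close> by \<open>t\<close> towards the vertex \<open>b\<close> cannot decrease the objective.\<close>
      have descent: "0 \<le> 2 * (\<Sum>v\<in>V. c v * d v) + t * (\<Sum>v\<in>V. (d v)\<^sup>2)" if t: "0 < t" "t \<le> 1" for t
      proof -
        define l' where "l' = (\<lambda>b'. (1 - t) * l b' + t * of_bool (b' = b))"
        have "sum l' F = 1"
          using F b by (simp add: l'_def sum.distrib flip: sum_distrib_left)
            (simp add: lsum of_bool_def sum.delta)
        moreover have "0 \<le> l' b'" "l' b' \<le> 1" for b'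
        proof -
          show "0 \<le> l' b'" using t l0[of b'] by (simp add: l'_def)
          have "(1 - t) * l b' \<le> (1 - t) * 1"
            using t l1[of b'] by (intro mult_left_mono) auto
          then show "l' b' \<le> 1" using t by (auto simp: l'_def of_bool_def)
        qed
        ultimately have "l' \<in> K" by (auto simp: K_def)
        then have "g l \<le> g l'" by (rule min)
        have p': "p l' v = p l v + t * d v" for v
        proof -
          have "p l' v = (1 - t) * p l v + t * (\<Sum>b'\<in>F. of_bool (b' = b) * M b' v)"
            by (simp add: p_def l'_def sum_distrib_left algebra_simps sum.distrib sum_subtractf)
          also have "(\<Sum>b'\<in>F. of_bool (b' = b) * M b' v) = M b v"
            using F b by (simp add: of_bool_def if_distrib[of "\<lambda>x. x * _"] sum.delta cong: if_cong)
          finally show ?thesis by (simp add: d_def algebra_simps)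
        qed
        have "(max 0 (p l' v - w v))\<^sup>2 \<le> (c v + t * d v)\<^sup>2" for v
        proof -
          have "p l' v - w v \<le> c v + t * d v" by (simp add: p' c_def)
          then show ?thesis
            by (cases "p l' v - w v \<le> 0") (simp_all add: max_def power_mono)
        qed
        then have "g l' \<le> (\<Sum>v\<in>V. (c v + t * d v)\<^sup>2)"
          unfolding g_def by (intro sum_mono)
        also have "\<dots> = (\<Sum>v\<in>V. (c v)\<^sup>2) + t * (2 * (\<Sum>v\<in>V. c v * d v) + t * (\<Sum>v\<in>V. (d v)\<^sup>2))"
          by (simp add: power2_eq_square algebra_simps sum.distrib sum_distrib_left)
        finally have "0 \<le> t * (2 * (\<Sum>v\<in>V. c v * d v) + t * (\<Sum>v\<in>V. (d v)\<^sup>2))"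
          using \<open>g l \<le> g l'\<close> by (simp add: g_def c_def)
        then show ?thesis using t by (simp add: zero_le_mult_iff)
      qed
      have "0 \<le> (\<Sum>v\<in>V. c v * d v)"
      proof (rule ccontr)
        assume neg: "\<not> ?thesis"
        define e where "e = - (\<Sum>v\<in>V. c v * d v)"
        define D where "D = (\<Sum>v\<in>V. (d v)\<^sup>2)"
        have e: "0 < e" and D: "0 \<le> D" using neg by (auto simp: e_def D_def sum_nonneg)
        define t where "t = min 1 (e / (D + 1))"
        have "0 < t" "t \<le> 1" using e D by (auto simp: t_def)
        then have "2 * e \<le> t * D" using descent[of t] by (simp add: e_def D_def)
        also have "\<dots> \<le> e / (D + 1) * D" using D by (intro mult_right_mono) (auto simp: t_def)
        also have "\<dots> \<le> e" using e D by (simp add: field_simps)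
        finally show False using e by simp
      qed
      moreover have "(\<Sum>v\<in>V. c v * d v) =
          (\<Sum>v\<in>V. c v * M b v) - (\<Sum>v\<in>V. c v * w v) - (\<Sum>v\<in>V. c v * (p l v - w v))"
        by (simp add: d_def algebra_simps sum.distrib sum_subtractf)
      moreover have "c v * (p l v - w v) = (c v)\<^sup>2" for v
        by (auto simp: c_def max_def power2_eq_square)
      ultimately show ?thesis using pos by simp
    qed
    then show ?thesis using c0 by blast
  qed
qed

section \<open>The blocker of an ideal clutter\<close>

definition covers :: "'v set \<Rightarrow> 'v set set \<Rightarrow> 'v set set" where
  "covers V \<C> = {B. B \<subseteq> V \<and> (\<forall>A\<in>\<C>. A \<inter> B \<noteq> {})}"

lemma finite_covers: "finite V \<Longrightarrow> finite (covers V \<C>)"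
  by (rule finite_subset[of _ "Pow V"]) (auto simp: covers_def)

lemma sum_mult_of_bool_mem:
  fixes c :: "'v \<Rightarrow> real"
  assumes "finite V" "B \<subseteq> V"
  shows "(\<Sum>v\<in>V. c v * of_bool (v \<in> B)) = sum c B"
proof -
  have "(\<Sum>v\<in>V. c v * of_bool (v \<in> B)) = (\<Sum>v\<in>V. if v \<in> B then c v else 0)"
    by (intro sum.cong) auto
  also have "\<dots> = sum c (V \<inter> B)" using assms by (simp add: sum.inter_restrict)
  finally show ?thesis using assms by (simp add: Int_absorb1)
qed

lemma sum_weighted_sets:
  fixes c :: "'v \<Rightarrow> real" and m :: "'v set \<Rightarrow> real"
  assumes "finite V" "\<And>B. B \<in> F \<Longrightarrow> B \<subseteq> V"
  shows "(\<Sum>v\<in>V. c v * (\<Sum>B\<in>F. m B * of_bool (v \<in> B))) = (\<Sum>B\<in>F. m B * sum c B)"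
proof -
  have "(\<Sum>v\<in>V. c v * (\<Sum>B\<in>F. m B * of_bool (v \<in> B)))
      = (\<Sum>B\<in>F. \<Sum>v\<in>V. m B * (c v * of_bool (v \<in> B)))"
    by (subst sum.swap) (simp add: sum_distrib_left mult_ac)
  also have "\<dots> = (\<Sum>B\<in>F. m B * sum c B)"
    using assms by (intro sum.cong) (simp_all add: sum_mult_of_bool_mem Int_absorb1 flip: sum_distrib_left)
  finally show ?thesis .
qed

lemma convex_combination_ge:
  fixes m h :: "'b \<Rightarrow> real"
  assumes "\<And>b. b \<in> F \<Longrightarrow> 0 \<le> m b" "sum m F = 1" "\<And>b. b \<in> F \<Longrightarrow> a \<le> h b"
  shows "a \<le> (\<Sum>b\<in>F. m b * h b)"
proof -
  have "a = (\<Sum>b\<in>F. m b * a)" using assms(2) by (simp flip: sum_distrib_right)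
  also have "\<dots> \<le> (\<Sum>b\<in>F. m b * h b)" using assms by (intro sum_mono mult_left_mono)
  finally show ?thesis .
qed

lemma integral_feasible_support_cover:
  assumes V: "finite V" and sub: "\<And>A. A \<in> \<C> \<Longrightarrow> A \<subseteq> V"
    and x: "cover_feasible V \<C> x" "\<forall>v\<in>V. x v \<in> \<int>"
  shows "{v\<in>V. 1 \<le> x v} \<in> covers V \<C>"
proof -
  have "\<exists>v\<in>A. 1 \<le> x v" if A: "A \<in> \<C>" for A
  proof (rule ccontr)
    assume no: "\<not> (\<exists>v\<in>A. 1 \<le> x v)"
    have "x v \<le> 0" if v: "v \<in> A" for v
    proof -
      have "x v \<in> \<int>" using x(2) v sub[OF A] by auto
      then obtain a :: int where a: "x v = of_int a" by (rule Ints_cases)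
      have "x v < 1" using no v by auto
      then show ?thesis using a by simp
    qed
    then have "sum x A \<le> 0" by (rule sum_nonpos)
    then show False using x(1) A by (auto simp: cover_feasible_def)
  qed
  then show ?thesis using sub by (fastforce simp: covers_def)
qed

text \<open>
  Otherwise some nonnegative objective \<open>d\<close> would be smaller at \<open>y\<close> than at every cover. Scaling and
  rounding up makes \<open>d\<close> integral without losing this. But then an integral optimal solution costs at
  least as much as the cover on which it is positive, hence more than \<open>y\<close>.
\<close>

lemma ideal_feasible_dominates_covers:
  assumes V: "finite V" and sub: "\<And>A. A \<in> \<C> \<Longrightarrow> A \<subseteq> V"
    and id: "ideal_clutter V \<C>" and y: "cover_feasible V \<C> y"
  shows "\<exists>m. (\<forall>B\<in>covers V \<C>. 0 \<le> m B) \<and> sum m (covers V \<C>) = 1 \<and>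
             (\<forall>v\<in>V. (\<Sum>B\<in>covers V \<C>. m B * of_bool (v \<in> B)) \<le> y v)"
proof (rule ccontr)
  assume "\<not> ?thesis"
  then obtain d :: "'a \<Rightarrow> real" where d0: "\<forall>v\<in>V. 0 \<le> d v"
    and d: "\<forall>B\<in>covers V \<C>. (\<Sum>v\<in>V. d v * y v) < (\<Sum>v\<in>V. d v * of_bool (v \<in> B))"
    using domination_or_separation[OF finite_covers[OF V] V, of \<C> "\<lambda>B v. of_bool (v \<in> B)" y]
    by blast
  have d: "(\<Sum>v\<in>V. d v * y v) < sum d B" if "B \<in> covers V \<C>" for B
    using d that V sum_mult_of_bool_mem[of V B d] by (auto simp: covers_def)
  have y0: "0 \<le> y v" if "v \<in> V" for v using y that by (auto simp: cover_feasible_def)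
  have "eventually (\<lambda>N. \<forall>B\<in>covers V \<C>. sum y V < real N * (sum d B - (\<Sum>v\<in>V. d v * y v))) at_top"
  proof (intro eventually_ball_finite finite_covers[OF V] ballI)
    fix B assume "B \<in> covers V \<C>"
    then have pos: "0 < sum d B - (\<Sum>v\<in>V. d v * y v)" using d by simp
    have "LIM N at_top. real N * (sum d B - (\<Sum>v\<in>V. d v * y v)) :> at_top"
      using filterlim_tendsto_pos_mult_at_top[OF tendsto_const pos filterlim_real_sequentially]
      by (simp add: mult.commute)
    then show "eventually (\<lambda>N. sum y V < real N * (sum d B - (\<Sum>v\<in>V. d v * y v))) at_top"
      by (simp add: filterlim_at_top_dense)
  qed
  then obtain N where N: "\<And>B. B \<in> covers V \<C> \<Longrightarrow> sum y V < real N * (sum d B - (\<Sum>v\<in>V. d v * y v))"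
    by (auto simp: eventually_sequentially)
  \<comment> \<open>Rounding raises the cost of \<open>y\<close> by at most \<open>sum y V\<close>, and \<open>N\<close> makes every gap larger.\<close>
  define w where "w v = \<lceil>real N * d v\<rceil>" for v
  have w0: "\<forall>v\<in>V. 0 \<le> w v"
  proof
    fix v assume "v \<in> V"
    then have "0 \<le> real N * d v" using d0 by simp
    then show "0 \<le> w v" unfolding w_def by linarith
  qed
  have w1: "real N * d v \<le> of_int (w v)" "of_int (w v) \<le> real N * d v + 1" for v
    unfolding w_def by linarith+
  obtain x where x: "cover_feasible V \<C> x" "\<forall>v\<in>V. x v \<in> \<int>"
    and opt: "(\<Sum>v\<in>V. of_int (w v) * x v) \<le> (\<Sum>v\<in>V. of_int (w v) * y v)"
    using id w0 y unfolding ideal_clutter_def by blast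
  define B where "B = {v\<in>V. 1 \<le> x v}"
  have B: "B \<in> covers V \<C>"
    unfolding B_def by (rule integral_feasible_support_cover[OF V sub x])
  have "real N * sum d B \<le> (\<Sum>v\<in>B. of_int (w v))"
    using w1 by (simp add: sum_distrib_left sum_mono)
  also have "\<dots> \<le> (\<Sum>v\<in>B. of_int (w v) * x v)"
    using w0 by (intro sum_mono) (auto simp: B_def mult_le_cancel_left1)
  also have "\<dots> \<le> (\<Sum>v\<in>V. of_int (w v) * x v)"
    using V w0 x(1) by (intro sum_mono2) (auto simp: B_def cover_feasible_def)
  also have "\<dots> \<le> (\<Sum>v\<in>V. of_int (w v) * y v)" by (rule opt)
  also have "\<dots> \<le> (\<Sum>v\<in>V. (real N * d v + 1) * y v)"
    using w1 y0 by (intro sum_mono mult_right_mono)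
  also have "\<dots> = real N * (\<Sum>v\<in>V. d v * y v) + sum y V"
    by (simp add: algebra_simps sum.distrib sum_distrib_left)
  finally show False using N[OF B] by (simp add: algebra_simps)
qed

text \<open>
  Lehman's theorem: the blocker of an ideal clutter is ideal. A vector \<open>c\<close> separating \<open>x\<close> from the members
  is, after scaling, a fractional solution for \<open>\<C>\<close>, hence dominates a convex combination of covers;
  since \<open>x\<close> has value at least one on each cover, its product with \<open>c\<close> is too large to be separated.
\<close>

lemma ideal_blocker_dominates_members:
  fixes x :: "'v \<Rightarrow> real"
  assumes V: "finite V" and sub: "\<And>A. A \<in> \<C> \<Longrightarrow> A \<subseteq> V"
    and id: "ideal_clutter V \<C>"
    and x0: "\<And>v. v \<in> V \<Longrightarrow> 0 \<le> x v" and x: "\<And>B. B \<in> covers V \<C> \<Longrightarrow> 1 \<le> sum x B"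
  shows "\<exists>l. (\<forall>A\<in>\<C>. 0 \<le> l A) \<and> sum l \<C> = 1 \<and> (\<forall>v\<in>V. (\<Sum>A\<in>\<C>. l A * of_bool (v \<in> A)) \<le> x v)"
proof (rule ccontr)
  assume no: "\<not> ?thesis"
  have C: "finite \<C>" using V sub by (meson Pow_iff finite_Pow_iff finite_subset subsetI)
  obtain c :: "'v \<Rightarrow> real" where c0: "\<forall>v\<in>V. 0 \<le> c v"
    and c: "\<forall>A\<in>\<C>. (\<Sum>v\<in>V. c v * x v) < (\<Sum>v\<in>V. c v * of_bool (v \<in> A))"
    using no domination_or_separation[OF C V, of "\<lambda>A v. of_bool (v \<in> A)" x] by blast
  define s where "s = (\<Sum>v\<in>V. c v * x v)"
  have s: "s < sum c A" if "A \<in> \<C>" for A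
    using c that V sub sum_mult_of_bool_mem[of V A c] by (auto simp: s_def)
  have "\<C> \<noteq> {}" using x[of "{}"] by (auto simp: covers_def)
  define \<gamma> where "\<gamma> = Min (sum c ` \<C>)"
  have g: "\<gamma> \<le> sum c A" if "A \<in> \<C>" for A using that C by (simp add: \<gamma>_def)
  have gs: "s < \<gamma>" using C \<open>\<C> \<noteq> {}\<close> s by (simp add: \<gamma>_def)
  have "0 \<le> s" unfolding s_def using c0 x0 by (intro sum_nonneg) simp
  with gs have gpos: "0 < \<gamma>" by simp
  have "cover_feasible V \<C> (\<lambda>v. c v / \<gamma>)"
    using g gpos c0 by (auto simp: cover_feasible_def simp flip: sum_divide_distrib)
  from ideal_feasible_dominates_covers[OF V sub id this]
  obtain m where m0: "\<And>B. B \<in> covers V \<C> \<Longrightarrow> 0 \<le> m B" and m1: "sum m (covers V \<C>) = 1"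
    and m: "\<And>v. v \<in> V \<Longrightarrow> (\<Sum>B\<in>covers V \<C>. m B * of_bool (v \<in> B)) \<le> c v / \<gamma>"
    by blast
  have "1 \<le> (\<Sum>B\<in>covers V \<C>. m B * sum x B)"
    using m0 m1 x by (rule convex_combination_ge)
  also have "\<dots> = (\<Sum>v\<in>V. x v * (\<Sum>B\<in>covers V \<C>. m B * of_bool (v \<in> B)))"
    using V by (intro sum_weighted_sets[symmetric]) (auto simp: covers_def)
  also have "\<dots> \<le> (\<Sum>v\<in>V. x v * (c v / \<gamma>))"
    using m x0 by (intro sum_mono mult_left_mono)
  also have "\<dots> = s / \<gamma>" by (simp add: s_def sum_divide_distrib mult.commute)
  finally show False using gs gpos by simp
qed

text \<open>
  Deleted elements get weight zero, and a fractional solution of the deletion extends to the whole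
  ground set by ones, at the same cost.
\<close>

lemma ideal_clutter_deletion:
  assumes V: "finite V" and sub: "\<And>A. A \<in> \<C> \<Longrightarrow> A \<subseteq> V"
    and id: "ideal_clutter V \<C>" and U: "U \<subseteq> V"
  shows "ideal_clutter U {A\<in>\<C>. A \<subseteq> U}"
  unfolding ideal_clutter_def
proof (intro allI impI)
  fix w :: "'a \<Rightarrow> int" assume w: "\<forall>u\<in>U. 0 \<le> w u"
  define w' where "w' v = (if v \<in> U then w v else 0)" for v
  have cost: "(\<Sum>v\<in>V. of_int (w' v) * x v) = (\<Sum>v\<in>U. of_int (w v) * x v)" for x :: "'a \<Rightarrow> real"
    using V U by (intro sum.mono_neutral_cong_right) (auto simp: w'_def)
  obtain x where x: "cover_feasible V \<C> x" "\<forall>v\<in>V. x v \<in> \<int>"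
    and opt: "\<And>y. cover_feasible V \<C> y \<Longrightarrow>
      (\<Sum>v\<in>V. of_int (w' v) * x v) \<le> (\<Sum>v\<in>V. of_int (w' v) * y v)"
    using id w unfolding ideal_clutter_def by (metis order_refl w'_def)
  have "(\<Sum>v\<in>U. of_int (w v) * x v) \<le> (\<Sum>v\<in>U. of_int (w v) * y v)"
    if y: "cover_feasible U {A\<in>\<C>. A \<subseteq> U} y" for y
  proof -
    define y' where "y' v = (if v \<in> U then y v else 1)" for v
    have y'0: "0 \<le> y' v" for v using y by (auto simp: y'_def cover_feasible_def)
    have "1 \<le> sum y' A" if A: "A \<in> \<C>" for A
    proof (cases "A \<subseteq> U")
      case True
      then have "sum y' A = sum y A" by (intro sum.cong) (auto simp: y'_def)
      then show ?thesis using y A True by (auto simp: cover_feasible_def)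
    next
      case False
      then obtain v where v: "v \<in> A" "v \<notin> U" by auto
      have "y' v \<le> sum y' A"
        using v A sub V y'0 by (intro member_le_sum) (auto intro: finite_subset)
      then show ?thesis using v by (simp add: y'_def)
    qed
    then have "cover_feasible V \<C> y'" using y'0 by (auto simp: cover_feasible_def)
    from opt[OF this] have "(\<Sum>v\<in>U. of_int (w v) * x v) \<le> (\<Sum>v\<in>U. of_int (w v) * y' v)"
      by (simp add: cost)
    also have "\<dots> = (\<Sum>v\<in>U. of_int (w v) * y v)" by (intro sum.cong) (auto simp: y'_def)
    finally show ?thesis .
  qed
  moreover have "cover_feasible U {A\<in>\<C>. A \<subseteq> U} x" "\<forall>u\<in>U. x u \<in> \<int>"
    using x U by (auto simp: cover_feasible_def)
  ultimately show "\<exists>x. cover_feasible U {A\<in>\<C>. A \<subseteq> U} x \<and> (\<forall>u\<in>U. x u \<in> \<int>) \<and>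
      (\<forall>y. cover_feasible U {A\<in>\<C>. A \<subseteq> U} y \<longrightarrow>
        (\<Sum>u\<in>U. of_int (w u) * x u) \<le> (\<Sum>u\<in>U. of_int (w u) * y u))"
    by blast
qed


section \<open>Cube-ideal sets\<close>

lemma sum_fun_apply: "(\<Sum>a\<in>F. h a) i = (\<Sum>a\<in>F. h a i)"
  for h :: "'b \<Rightarrow> nat \<Rightarrow> real"
  by (induction F rule: infinite_finite_induct) auto

lemma convex_real_space: "convex (real_space n)"
  by (auto simp: convex_def real_space_def scaleR_fun_def)

lemma affine_at_least_convex:
  fixes a :: "'b \<Rightarrow> real"
  assumes "finite I"
  shows "convex {x :: nat \<Rightarrow> real. c \<le> (\<Sum>i\<in>I. a i * x (e i) + b i)}"
proof (rule convexI)
  fix x y :: "nat \<Rightarrow> real" and s t :: real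
  assume x: "x \<in> {x. c \<le> (\<Sum>i\<in>I. a i * x (e i) + b i)}"
    and y: "y \<in> {x. c \<le> (\<Sum>i\<in>I. a i * x (e i) + b i)}" and st: "0 \<le> s" "0 \<le> t" "s + t = 1"
  have "c = s * c + t * c" using st by (simp flip: distrib_right)
  also have "\<dots> \<le> s * (\<Sum>i\<in>I. a i * x (e i) + b i) + t * (\<Sum>i\<in>I. a i * y (e i) + b i)"
    using x y st by (intro add_mono mult_left_mono) auto
  also have "\<dots> = (\<Sum>i\<in>I. a i * (s * x (e i) + t * y (e i)) + (s + t) * b i)"
    by (simp add: sum_distrib_left sum.distrib algebra_simps)
  finally show "s *\<^sub>R x + t *\<^sub>R y \<in> {x. c \<le> (\<Sum>i\<in>I. a i * x (e i) + b i)}"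
    using st by (simp add: scaleR_fun_def)
qed

lemma convex_satisfies:
  assumes "ineq_in_dim n q"
  shows "convex {x. satisfies x q}"
proof (cases q)
  case (Lower i)
  then show ?thesis using affine_at_least_convex[of "{()}" 0 "\<lambda>_. 1" "\<lambda>_. i" "\<lambda>_. 0"] by simp
next
  case (Upper i)
  then show ?thesis
    using affine_at_least_convex[of "{()}" 0 "\<lambda>_. -1" "\<lambda>_. i" "\<lambda>_. 1"] by simp
next
  case (Gen_Cover I J)
  then have "finite I" "finite J" "I \<inter> J = {}" using assms by (auto intro: finite_subset)
  moreover from this have "(\<Sum>i\<in>I\<union>J. (if i \<in> I then 1 else -1) * x i + (if i \<in> I then 0 else 1))
      = (\<Sum>i\<in>I. x i) + (\<Sum>j\<in>J. 1 - x j)" for x :: "nat \<Rightarrow> real"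
    by (subst sum.union_disjoint) (auto intro!: arg_cong2[of _ _ _ _ "(+)"] sum.cong)
  ultimately show ?thesis
    using affine_at_least_convex[of "I \<union> J" 1 "\<lambda>i. if i \<in> I then 1 else -1" "\<lambda>i. i"
        "\<lambda>i. if i \<in> I then 0 else 1"] Gen_Cover by simp
qed

text \<open>
  The system may always be taken to consist of all valid inequalities, so only one inclusion needs a proof.
\<close>

lemma cube_idealI:
  assumes S: "S \<subseteq> cube n"
    and hull: "\<And>z. z \<in> real_space n \<Longrightarrow>
      (\<And>q. ineq_in_dim n q \<Longrightarrow> \<forall>s\<in>S. satisfies s q \<Longrightarrow> satisfies z q) \<Longrightarrow> z \<in> convex hull S"
  shows "cube_ideal n S"
proof -
  define Q where "Q = {q. ineq_in_dim n q \<and> (\<forall>s\<in>S. satisfies s q)}"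
  have "convex hull S \<subseteq> real_space n"
    using S by (intro hull_minimal convex_real_space) (auto simp: cube_def)
  moreover have "convex hull S \<subseteq> {x. satisfies x q}" if "q \<in> Q" for q
    using that by (intro hull_minimal) (auto simp: Q_def intro: convex_satisfies)
  ultimately have "convex hull S = {x \<in> real_space n. \<forall>q\<in>Q. satisfies x q}"
    using hull by (auto simp: Q_def)
  moreover have "\<forall>q\<in>Q. ineq_in_dim n q" by (simp add: Q_def)
  ultimately show ?thesis using S unfolding cube_ideal_def by blast
qed

section \<open>The cuboid of a cube-ideal set\<close>

text \<open>
  Lower the weights greedily, one element at a time. An element that is finished stays finished: its
  weight is not touched again, and a set of weight one can only lose weight, which its lower bound
  forbids.
\<close>

lemma reduce_to_tight_weights:
  fixes w :: "'v \<Rightarrow> real"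
  assumes V: "finite V" and F: "finite F" "\<And>B. B \<in> F \<Longrightarrow> B \<subseteq> V"
    and w0: "\<And>v. v \<in> V \<Longrightarrow> 0 \<le> w v" and w: "\<And>B. B \<in> F \<Longrightarrow> 1 \<le> sum w B"
  shows "\<exists>u. (\<forall>v\<in>V. 0 \<le> u v \<and> u v \<le> w v) \<and> (\<forall>B\<in>F. 1 \<le> sum u B) \<and>
      (\<forall>v\<in>V. u v = 0 \<or> (\<exists>B\<in>F. v \<in> B \<and> sum u B = 1))"
proof -
  have fin: "finite B" if "B \<in> F" for B using F V that by (meson finite_subset)
  have "\<exists>u. (\<forall>v\<in>V. 0 \<le> u v \<and> u v \<le> w v) \<and> (\<forall>B\<in>F. 1 \<le> sum u B) \<and>
      (\<forall>v\<in>W. u v = 0 \<or> (\<exists>B\<in>F. v \<in> B \<and> sum u B = 1))" if "finite W" "W \<subseteq> V" for W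
    using that
  proof (induction W rule: finite_induct)
    case empty
    then show ?case using w0 w by (intro exI[of _ w]) auto
  next
    case (insert a W)
    then obtain u where u: "\<forall>v\<in>V. 0 \<le> u v \<and> u v \<le> w v" "\<forall>B\<in>F. 1 \<le> sum u B"
      and tight: "\<forall>v\<in>W. u v = 0 \<or> (\<exists>B\<in>F. v \<in> B \<and> sum u B = 1)" by auto
    \<comment> \<open>The largest amount that can be taken from the weight of \<open>a\<close>.\<close>
    define X where "X = insert (u a) ((\<lambda>B. sum u B - 1) ` {B\<in>F. a \<in> B})"
    define \<delta> where "\<delta> = Min X"
    have X: "finite X" "X \<noteq> {}" using F by (auto simp: X_def)
    have "\<delta> \<in> X" unfolding \<delta>_def using X by (rule Min_in)
    have \<delta>: "\<delta> \<le> u a" "\<And>B. B \<in> F \<Longrightarrow> a \<in> B \<Longrightarrow> \<delta> \<le> sum u B - 1"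
      unfolding \<delta>_def by (rule Min_le[OF X(1)], simp add: X_def)+
    have "0 \<le> \<delta>" using X u insert.prems unfolding \<delta>_def by (auto simp: X_def)
    define u' where "u' = u(a := u a - \<delta>)"
    have sum': "sum u' B = sum u B - (if a \<in> B then \<delta> else 0)" if B: "B \<in> F" for B
    proof (cases "a \<in> B")
      case True
      have "sum u' (B - {a}) = sum u (B - {a})" by (intro sum.cong) (auto simp: u'_def)
      then show ?thesis
        using True fin[OF B] by (simp add: sum.remove[of B a] u'_def)
    next
      case False
      then show ?thesis by (auto simp: u'_def intro!: sum.cong)
    qed
    have "\<forall>v\<in>V. 0 \<le> u' v \<and> u' v \<le> w v"
      using u \<open>0 \<le> \<delta>\<close> \<delta>(1) by (fastforce simp: u'_def)
    moreover have feas: "\<forall>B\<in>F. 1 \<le> sum u' B" using u(2) \<delta>(2) by (fastforce simp: sum')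
    moreover have "u' v = 0 \<or> (\<exists>B\<in>F. v \<in> B \<and> sum u' B = 1)" if v: "v \<in> insert a W" for v
    proof (cases "v = a")
      case True
      then show ?thesis using \<open>\<delta> \<in> X\<close> sum' by (fastforce simp: X_def u'_def)
    next
      case False
      then consider "u v = 0" | B where "B \<in> F" "v \<in> B" "sum u B = 1" using tight v by auto
      then show ?thesis
      proof cases
        case 1
        then show ?thesis using False by (simp add: u'_def)
      next
        case 2
        then have "sum u' B \<le> 1" using \<open>0 \<le> \<delta>\<close> by (simp add: sum')
        then show ?thesis using 2 feas by force
      qed
    qed
    ultimately show ?case by blast
  qed
  from this[OF V order_refl] show ?thesis .
qed

definition cuboid_ground :: "(nat \<Rightarrow> bool \<Rightarrow> 'v) \<Rightarrow> nat \<Rightarrow> 'v set" where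
  "cuboid_ground f n = (\<lambda>(i, b). f i b) ` ({1..n} \<times> UNIV)"

definition cuboid_member :: "(nat \<Rightarrow> bool \<Rightarrow> 'v) \<Rightarrow> nat \<Rightarrow> (nat \<Rightarrow> real) \<Rightarrow> 'v set" where
  "cuboid_member f n s = (\<lambda>i. f i (s i = 1)) ` {1..n}"

text \<open>
  The injection \<open>f\<close> names the two elements of a coordinate inside the given type of elements.
\<close>

locale cube_embedding =
  fixes f :: "nat \<Rightarrow> bool \<Rightarrow> 'v" and n :: nat and S :: "(nat \<Rightarrow> real) set"
  assumes f: "\<And>i j b c. f i b = f j c \<longleftrightarrow> i = j \<and> b = c"
    and S: "S \<subseteq> cube n"
begin

abbreviation V where "V \<equiv> cuboid_ground f n"
abbreviation \<C> where "\<C> \<equiv> cuboid_member f n ` S"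

lemma cube_value: "s \<in> S \<Longrightarrow> i \<in> {1..n} \<Longrightarrow> s i = 0 \<or> s i = 1"
  using S unfolding cube_def by blast

lemma finite_cuboid_ground: "finite V"
  by (simp add: cuboid_ground_def)

lemma cuboid_member_subset: "cuboid_member f n s \<subseteq> V"
  by (auto simp: cuboid_ground_def cuboid_member_def)

lemma in_cuboid_member_iff: "f i b \<in> cuboid_member f n s \<longleftrightarrow> i \<in> {1..n} \<and> (s i = 1 \<longleftrightarrow> b)"
  by (auto simp: cuboid_member_def f)

lemma in_cuboid_ground_iff: "f i b \<in> V \<longleftrightarrow> i \<in> {1..n}"
  by (force simp: cuboid_ground_def f)

lemma cuboid_clutter: "clutter V \<C>"
proof -
  have "cuboid_member f n s = cuboid_member f n t"
    if st: "cuboid_member f n s \<subseteq> cuboid_member f n t" for s t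
  proof -
    have "(s i = 1) = (t i = 1)" if "i \<in> {1..n}" for i
      using st that in_cuboid_member_iff[of i "s i = 1"] by blast
    then show ?thesis by (auto simp: cuboid_member_def)
  qed
  then show ?thesis
    using cuboid_member_subset finite_cuboid_ground by (auto simp: clutter_def)
qed

lemma common_element_iff_agree:
  assumes "T \<subseteq> S"
  shows "(\<exists>v\<in>V. \<forall>A\<in>cuboid_member f n ` T. v \<in> A) \<longleftrightarrow> agree_on_coordinate n T"
proof -
  have val: "s i = 0 \<longleftrightarrow> s i \<noteq> 1" if "s \<in> T" "i \<in> {1..n}" for s i
    using cube_value[of s i] that assms by auto
  have "(\<exists>v\<in>V. \<forall>A\<in>cuboid_member f n ` T. v \<in> A)
      \<longleftrightarrow> (\<exists>i\<in>{1..n}. \<exists>b. \<forall>s\<in>T. f i b \<in> cuboid_member f n s)"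
    by (auto simp: cuboid_ground_def)
  also have "\<dots> \<longleftrightarrow> (\<exists>i\<in>{1..n}. (\<forall>s\<in>T. s i = 0) \<or> (\<forall>s\<in>T. s i = 1))"
    using val by (auto simp: in_cuboid_member_iff ex_bool_eq)
  also have "\<dots> \<longleftrightarrow> agree_on_coordinate n T" by (auto simp: agree_on_coordinate_def)
  finally show ?thesis .
qed

lemma sum_cuboid_ground:
  fixes h :: "'v \<Rightarrow> real"
  shows "sum h V = (\<Sum>i=1..n. h (f i True) + h (f i False))"
proof -
  have "inj_on (\<lambda>(i, b). f i b) ({1..n} \<times> UNIV)" by (auto simp: inj_on_def f)
  then have "sum h V = (\<Sum>(i, b)\<in>{1..n} \<times> UNIV. h (f i b))"
    unfolding cuboid_ground_def by (subst sum.reindex) (auto intro!: sum.cong)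
  also have "\<dots> = (\<Sum>i=1..n. \<Sum>b\<in>UNIV. h (f i b))"
    by (rule sum.cartesian_product[symmetric])
  finally show ?thesis by (simp add: UNIV_bool add.commute)
qed

lemma sum_cuboid_member:
  fixes h :: "'v \<Rightarrow> real"
  assumes "s \<in> S"
  shows "sum h (cuboid_member f n s) = (\<Sum>i=1..n. s i * h (f i True) + (1 - s i) * h (f i False))"
proof -
  have "sum h (cuboid_member f n s) = (\<Sum>i=1..n. h (f i (s i = 1)))"
    unfolding cuboid_member_def by (subst sum.reindex) (auto simp: inj_on_def f)
  also have "\<dots> = (\<Sum>i=1..n. s i * h (f i True) + (1 - s i) * h (f i False))"
  proof (intro sum.cong refl)
    fix i assume "i \<in> {1..n}"
    then have "s i = 0 \<or> s i = 1" using cube_value[OF assms] by blast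
    then show "h (f i (s i = 1)) = s i * h (f i True) + (1 - s i) * h (f i False)" by auto
  qed
  finally show ?thesis .
qed

lemma literals_cover_cuboid:
  assumes IJ: "I \<subseteq> {1..n}" "J \<subseteq> {1..n}" and valid: "\<forall>s\<in>S. satisfies s (Gen_Cover I J)"
  shows "(\<lambda>i. f i True) ` I \<union> (\<lambda>j. f j False) ` J \<in> covers V \<C>"
proof -
  have "cuboid_member f n s \<inter> ((\<lambda>i. f i True) ` I \<union> (\<lambda>j. f j False) ` J) \<noteq> {}" if s: "s \<in> S" for s
  proof (rule ccontr)
    assume no: "\<not> ?thesis"
    have val: "s i = 0 \<or> s i = 1" if "i \<in> {1..n}" for i
      using cube_value[OF s that] .
    have "s i = 0" if "i \<in> I" for i
      using no that IJ val[of i] in_cuboid_member_iff[of i True s] by auto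
    moreover have "1 - s j = 0" if "j \<in> J" for j
      using no that IJ val[of j] in_cuboid_member_iff[of j False s] by auto
    ultimately have "\<not> satisfies s (Gen_Cover I J)" by simp
    then show False using valid s by blast
  qed
  then show ?thesis using IJ by (auto simp: covers_def in_cuboid_ground_iff)
qed

text \<open>
  The two elements of a coordinate form a cover, so their weights sum to at least one. If the sum were
  larger, each of the two would lie in a cover of weight one that avoids the other. The union of these
  covers without the two elements would still be a cover, because a member misses one of the two,
  and its weight would be less than one.
\<close>

lemma tight_weights_complementary:
  assumes u0: "\<And>v. v \<in> V \<Longrightarrow> 0 \<le> u v" and u: "\<And>B. B \<in> covers V \<C> \<Longrightarrow> 1 \<le> sum u B"
    and tight: "\<And>v. v \<in> V \<Longrightarrow> u v = 0 \<or> (\<exists>B\<in>covers V \<C>. v \<in> B \<and> sum u B = 1)"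
    and i: "i \<in> {1..n}"
  shows "u (f i True) + u (f i False) = (1::real)"
proof (rule antisym)
  have V: "f i b \<in> V" for b using i by (simp add: in_cuboid_ground_iff)
  have "{f i True, f i False} \<in> covers V \<C>"
    using V i by (auto simp: covers_def in_cuboid_member_iff)
  from u[OF this] show "1 \<le> u (f i True) + u (f i False)" by (simp add: f)
  show "u (f i True) + u (f i False) \<le> 1"
  proof (rule ccontr)
    assume big: "\<not> ?thesis"
    have finB: "finite B" if "B \<in> covers V \<C>" for B
      using that finite_cuboid_ground by (auto simp: covers_def intro: finite_subset)
    have nonneg: "0 \<le> u v" if "B \<in> covers V \<C>" "v \<in> B" for B v
      using that u0 by (auto simp: covers_def)
    have le1: "u (f i b) \<le> 1" for b
      using tight[OF V[of b]] member_le_sum[of "f i b" _ u] nonneg finB by fastforce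
    have "u (f i b) \<noteq> 0" for b using big le1[of "\<not> b"] by (cases b) auto
    then have "\<exists>B\<in>covers V \<C>. f i b \<in> B \<and> sum u B = 1" for b using tight[OF V] by blast
    then obtain B where B: "\<And>b. B b \<in> covers V \<C>" "\<And>b. f i b \<in> B b" "\<And>b. sum u (B b) = 1"
      by metis
    have other: "f i (\<not> b) \<notin> B b" for b
    proof
      assume "f i (\<not> b) \<in> B b"
      then have "sum u {f i b, f i (\<not> b)} \<le> sum u (B b)"
        using B finB nonneg[OF B(1)] by (intro sum_mono2) auto
      then show False using big B(3)[of b] by (cases b) (auto simp: f)
    qed
    define D where "D = (B True - {f i True}) \<union> (B False - {f i False})"
    have "cuboid_member f n s \<inter> D \<noteq> {}" if s: "s \<in> S" for s
    proof -
      \<comment> \<open>\<open>f i b\<close> is the element that the member of \<open>s\<close> misses.\<close>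
      define b where "b = (s i \<noteq> 1)"
      obtain v where v: "v \<in> cuboid_member f n s" "v \<in> B b"
        using B(1)[of b] s by (auto simp: covers_def)
      moreover have "v \<noteq> f i b" using v by (auto simp: in_cuboid_member_iff b_def)
      ultimately have "v \<in> D" by (cases b) (auto simp: D_def)
      then show ?thesis using v by auto
    qed
    then have "D \<in> covers V \<C>" using B(1) by (auto simp: covers_def D_def)
    then have "1 \<le> sum u D" by (rule u)
    also have "\<dots> \<le> sum u (B True - {f i True}) + sum u (B False - {f i False})"
      unfolding D_def using finB[OF B(1)] nonneg[OF B(1)]
      by (subst sum_Un) (auto intro!: sum_nonneg)
    also have "\<dots> = 2 - (u (f i True) + u (f i False))"
      using B finB[OF B(1)] by (simp add: sum_diff1)
    finally show False using big by simp
  qed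
qed

text \<open>
  A cover \<open>B\<close> of minimum weight is an optimal solution. To compare it with a fractional solution \<open>y\<close>,
  divide the weights by that of \<open>B\<close>, if this is positive. The tight weights \<open>u\<close> below them form a point \<open>z\<close> of the convex hull
  of \<open>S\<close>, because every generalized set covering inequality of the system expresses that \<open>u\<close> has
  value at least one on some cover. Since \<open>y\<close> has value at least one on every member, it pairs
  with \<open>u\<close> to at least one.
\<close>

lemma cuboid_ideal:
  assumes n: "1 \<le> n" and id: "cube_ideal n S"
  shows "ideal_clutter V \<C>"
  unfolding ideal_clutter_def
proof (intro allI impI)
  fix w :: "'v \<Rightarrow> int" assume w: "\<forall>v\<in>V. 0 \<le> w v"
  define W where "W = (\<lambda>B. \<Sum>v\<in>B. real_of_int (w v))"
  have "V \<in> covers V \<C>"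
    using n cuboid_member_subset by (fastforce simp: covers_def cuboid_member_def)
  then obtain B where B: "B \<in> covers V \<C>" and Bmin: "\<And>B'. B' \<in> covers V \<C> \<Longrightarrow> W B \<le> W B'"
    using finite_covers[OF finite_cuboid_ground]
    by (metis (mono_tags, lifting) arg_min_if_finite(1) arg_min_least empty_iff)
  define x where "x v = (of_bool (v \<in> B) :: real)" for v
  have "1 \<le> sum x A" if A: "A \<in> \<C>" for A
  proof -
    have finA: "finite A" using A by (auto simp: cuboid_member_def)
    obtain v where v: "v \<in> A" "v \<in> B" using B A by (auto simp: covers_def)
    have "x v \<le> sum x A" using v finA by (intro member_le_sum) (auto simp: x_def)
    then show ?thesis using v by (simp add: x_def)
  qed
  then have feas: "cover_feasible V \<C> x" by (simp add: cover_feasible_def x_def)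
  have cost: "(\<Sum>v\<in>V. of_int (w v) * x v) = W B"
    unfolding x_def W_def using B finite_cuboid_ground
    by (intro sum_mult_of_bool_mem) (auto simp: covers_def)
  have "W B \<le> (\<Sum>v\<in>V. of_int (w v) * y v)" if y: "cover_feasible V \<C> y" for y
  proof (cases "W B \<le> 0")
    case True
    also have "0 \<le> (\<Sum>v\<in>V. of_int (w v) * y v)"
      using w y by (intro sum_nonneg) (auto simp: cover_feasible_def)
    finally show ?thesis .
  next
    case False
    have sub: "B' \<subseteq> V" if "B' \<in> covers V \<C>" for B' using that by (simp add: covers_def)
    have w0: "0 \<le> of_int (w v) / W B" if "v \<in> V" for v using w False that by simp
    have w1: "1 \<le> (\<Sum>v\<in>B'. of_int (w v) / W B)" if "B' \<in> covers V \<C>" for B'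
      using Bmin[OF that] False by (simp add: W_def flip: sum_divide_distrib)
    have "\<exists>u. (\<forall>v\<in>V. 0 \<le> u v \<and> u v \<le> of_int (w v) / W B) \<and> (\<forall>B'\<in>covers V \<C>. 1 \<le> sum u B') \<and>
        (\<forall>v\<in>V. u v = 0 \<or> (\<exists>B'\<in>covers V \<C>. v \<in> B' \<and> sum u B' = 1))"
      using sub w0 w1
      by (rule reduce_to_tight_weights[OF finite_cuboid_ground finite_covers[OF finite_cuboid_ground]])
    then obtain u where u: "\<forall>v\<in>V. 0 \<le> u v \<and> u v \<le> of_int (w v) / W B"
        "\<forall>B'\<in>covers V \<C>. 1 \<le> sum u B'"
        "\<forall>v\<in>V. u v = 0 \<or> (\<exists>B'\<in>covers V \<C>. v \<in> B' \<and> sum u B' = 1)"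
      by (elim exE conjE)
    have pair: "u (f i True) + u (f i False) = 1" if "i \<in> {1..n}" for i
      using u by (intro tight_weights_complementary that) simp_all
    define z where "z i = (if i \<in> {1..n} then u (f i True) else 0)" for i
    have zF: "1 - z i = u (f i False)" if "i \<in> {1..n}" for i
      using pair[OF that] that by (simp add: z_def)
    have u0: "0 \<le> u (f i b)" if "i \<in> {1..n}" for i b
      using u(1) that by (simp add: in_cuboid_ground_iff)
    obtain Q where dim: "\<forall>q\<in>Q. ineq_in_dim n q"
      and Q: "convex hull S = {x \<in> real_space n. \<forall>q\<in>Q. satisfies x q}"
      using id by (auto simp: cube_ideal_def)
    have "satisfies z q" if q: "q \<in> Q" for q
    proof (cases q)
      case (Lower i)
      then show ?thesis using dim q u0 by (auto simp: z_def)
    next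
      case (Upper i)
      then have i: "i \<in> {1..n}" using dim q by auto
      then show ?thesis using Upper zF[OF i] u0[OF i, of False] by simp
    next
      case (Gen_Cover I J)
      then have "ineq_in_dim n (Gen_Cover I J)" using dim q by blast
      then have IJ: "I \<subseteq> {1..n}" "J \<subseteq> {1..n}" by simp_all
      have "\<forall>s\<in>S. satisfies s q" using Q q hull_subset[of S convex] by blast
      then have "1 \<le> sum u ((\<lambda>i. f i True) ` I \<union> (\<lambda>j. f j False) ` J)"
        using IJ Gen_Cover by (intro u(2)[rule_format] literals_cover_cuboid) auto
      also have "\<dots> = sum u ((\<lambda>i. f i True) ` I) + sum u ((\<lambda>j. f j False) ` J)"
        using IJ by (intro sum.union_disjoint) (auto simp: f intro: finite_subset)
      also have "sum u ((\<lambda>i. f i True) ` I) = (\<Sum>i\<in>I. z i)"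
        using IJ by (subst sum.reindex) (auto simp: inj_on_def f z_def intro!: sum.cong)
      also have "sum u ((\<lambda>j. f j False) ` J) = (\<Sum>j\<in>J. 1 - z j)"
        using IJ zF by (subst sum.reindex) (auto simp: inj_on_def f intro!: sum.cong)
      finally show ?thesis using Gen_Cover by simp
    qed
    then have "z \<in> convex hull S" unfolding Q by (simp add: real_space_def z_def)
    moreover have "convex hull S \<subseteq>
        {x. 1 \<le> (\<Sum>i\<in>{1..n}. (y (f i True) - y (f i False)) * x i + y (f i False))}"
    proof (intro hull_minimal subsetI affine_at_least_convex CollectI)
      fix s assume s: "s \<in> S"
      then have "1 \<le> sum y (cuboid_member f n s)" using y by (auto simp: cover_feasible_def)
      then show "1 \<le> (\<Sum>i\<in>{1..n}. (y (f i True) - y (f i False)) * s i + y (f i False))"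
        by (simp add: sum_cuboid_member[OF s] algebra_simps)
    qed simp
    ultimately have "1 \<le> (\<Sum>i\<in>{1..n}. (y (f i True) - y (f i False)) * z i + y (f i False))"
      by blast
    also have "\<dots> = (\<Sum>i\<in>{1..n}. u (f i True) * y (f i True) + u (f i False) * y (f i False))"
    proof (intro sum.cong refl)
      fix i assume i: "i \<in> {1..n}"
      then have "z i = u (f i True)" by (simp add: z_def)
      then show "(y (f i True) - y (f i False)) * z i + y (f i False)
          = u (f i True) * y (f i True) + u (f i False) * y (f i False)"
        by (simp add: algebra_simps flip: zF[OF i])
    qed
    also have "\<dots> = (\<Sum>v\<in>V. u v * y v)" by (simp add: sum_cuboid_ground)
    also have "\<dots> \<le> (\<Sum>v\<in>V. of_int (w v) / W B * y v)"
      using u(1) y by (intro sum_mono mult_right_mono) (auto simp: cover_feasible_def)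
    also have "\<dots> = (\<Sum>v\<in>V. of_int (w v) * y v) / W B" by (simp add: sum_divide_distrib)
    finally show ?thesis using False by (simp add: field_simps)
  qed
  then show "\<exists>x. cover_feasible V \<C> x \<and> (\<forall>u\<in>V. x u \<in> \<int>) \<and>
      (\<forall>y. cover_feasible V \<C> y \<longrightarrow>
        (\<Sum>u\<in>V. of_int (w u) * x u) \<le> (\<Sum>u\<in>V. of_int (w u) * y u))"
    using feas cost by (intro exI[of _ x]) (auto simp: x_def)
qed

end


section \<open>The core of an ideal clutter\<close>

text \<open>
  Take a minimal \<open>U\<close> whose deletion minor has no common element. If \<open>u\<close> is deleted as well, an
  element \<open>v\<close> becomes common, which says that every member avoiding \<open>u\<close> contains \<open>v\<close>. Quantifying over
  \<open>V\<close> instead of \<open>U\<close> in the first conclusion ensures that some member remains, as \<open>V\<close> is nonempty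
  in the application.
\<close>

lemma deletion_with_two_covers:
  assumes V: "finite V" and no_common: "\<And>v. v \<in> V \<Longrightarrow> \<exists>A\<in>\<C>. v \<notin> A"
    and sub: "\<And>A. A \<in> \<C> \<Longrightarrow> A \<subseteq> V"
  shows "\<exists>U\<subseteq>V. (\<forall>v\<in>V. \<exists>A\<in>{A\<in>\<C>. A \<subseteq> U}. v \<notin> A) \<and>
      (\<forall>u\<in>U. \<exists>v\<in>U. v \<noteq> u \<and> {u, v} \<in> covers U {A\<in>\<C>. A \<subseteq> U})"
proof -
  define P where "P U \<longleftrightarrow> U \<subseteq> V \<and> (\<forall>v\<in>V. \<exists>A\<in>\<C>. A \<subseteq> U \<and> v \<notin> A)" for U
  have "P V" using no_common sub by (auto simp: P_def)
  then obtain U where U: "P U" and min: "\<And>U'. P U' \<Longrightarrow> card U \<le> card U'"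
    using ex_has_least_nat[of P V card] by blast
  have "finite U" using U V by (auto simp: P_def intro: finite_subset)
  have "\<exists>v\<in>U. v \<noteq> u \<and> {u, v} \<in> covers U {A\<in>\<C>. A \<subseteq> U}" if u: "u \<in> U" for u
  proof -
    have "card (U - {u}) < card U" using u \<open>finite U\<close> by (rule card_Diff1_less[rotated])
    then have "\<not> P (U - {u})" using min by (meson not_less)
    moreover have "U - {u} \<subseteq> V" using U unfolding P_def by blast
    ultimately obtain v where v: "\<forall>A\<in>\<C>. A \<subseteq> U - {u} \<longrightarrow> v \<in> A" unfolding P_def by blast
    obtain A where A: "A \<in> \<C>" "A \<subseteq> U" "u \<notin> A" using U u unfolding P_def by (meson subsetD)
    then have "v \<in> A" using v by blast
    then have "v \<in> U" "v \<noteq> u" using A by auto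
    moreover have "u \<in> A' \<or> v \<in> A'" if "A' \<in> \<C>" "A' \<subseteq> U" for A' using v that by blast
    then have "{u, v} \<in> covers U {A\<in>\<C>. A \<subseteq> U}"
      using u \<open>v \<in> U\<close> by (simp add: covers_def)
    ultimately show ?thesis by (intro bexI[of _ v] conjI)
  qed
  note partner = this
  show ?thesis
  proof (intro exI[of _ U] conjI ballI)
    show "U \<subseteq> V" using U by (simp add: P_def)
    fix v assume "v \<in> V"
    then obtain A where "A \<in> \<C>" "A \<subseteq> U" "v \<notin> A" using U unfolding P_def by meson
    then show "\<exists>A\<in>{A\<in>\<C>. A \<subseteq> U}. v \<notin> A" by (intro bexI[of _ A]) simp_all
  qed (rule partner)
qed

definition core :: "'v set \<Rightarrow> 'v set set \<Rightarrow> 'v set set" where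
  "core U \<D> = {A\<in>\<D>. \<forall>u v. u \<noteq> v \<longrightarrow> {u, v} \<in> covers U \<D> \<longrightarrow> \<not> {u, v} \<subseteq> A}"

text \<open>
  A convex combination of members below \<open>x\<close> has value at least one on every two-element cover,
  while \<open>x\<close> has value at most one there. Hence it equals \<open>x\<close> on the cover, and members that contain both
  elements have coefficient zero.
\<close>

lemma core_convex_combination:
  fixes x :: "'v \<Rightarrow> real"
  assumes U: "finite U" and sub: "\<And>A. A \<in> \<D> \<Longrightarrow> A \<subseteq> U" and id: "ideal_clutter U \<D>"
    and partner: "\<And>u. u \<in> U \<Longrightarrow> \<exists>v\<in>U. v \<noteq> u \<and> {u, v} \<in> covers U \<D>"
    and x0: "\<And>u. u \<in> U \<Longrightarrow> 0 \<le> x u" and x: "\<And>B. B \<in> covers U \<D> \<Longrightarrow> 1 \<le> sum x B"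
    and tight: "\<And>u v. u \<noteq> v \<Longrightarrow> {u, v} \<in> covers U \<D> \<Longrightarrow> x u + x v \<le> 1"
  shows "\<exists>l. (\<forall>A\<in>core U \<D>. 0 \<le> l A) \<and> sum l (core U \<D>) = 1 \<and>
    (\<forall>u\<in>U. (\<Sum>A\<in>core U \<D>. l A * of_bool (u \<in> A)) = x u)"
proof -
  obtain l where l0: "\<And>A. A \<in> \<D> \<Longrightarrow> 0 \<le> l A" and l1: "sum l \<D> = 1"
    and l: "\<And>u. u \<in> U \<Longrightarrow> (\<Sum>A\<in>\<D>. l A * of_bool (u \<in> A)) \<le> x u"
    using ideal_blocker_dominates_members[OF U sub id x0 x] by blast
  have D: "finite \<D>" using U sub by (meson Pow_iff finite_Pow_iff finite_subset subsetI)
  define L where "L u = (\<Sum>A\<in>\<D>. l A * of_bool (u \<in> A))" for u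
  have pair: "x u = L u \<and> (\<forall>A\<in>\<D>. {u, v} \<subseteq> A \<longrightarrow> l A = 0)"
    if uv: "u \<noteq> v" "{u, v} \<in> covers U \<D>" for u v
  proof -
    have uvU: "u \<in> U" "v \<in> U" using uv by (auto simp: covers_def)
    have nonneg: "0 \<le> l A * (of_bool (u \<in> A) + of_bool (v \<in> A) - 1)" if "A \<in> \<D>" for A
      using uv l0[OF that] that by (auto simp: covers_def)
    have eq: "L u + L v - 1 = (\<Sum>A\<in>\<D>. l A * (of_bool (u \<in> A) + of_bool (v \<in> A) - 1))"
      by (simp only: L_def right_diff_distrib distrib_left sum.distrib sum_subtractf l1 mult_1_right)
    also have "\<dots> \<ge> 0" using nonneg by (rule sum_nonneg)
    finally have "1 \<le> L u + L v" by simp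
    moreover have "L u \<le> x u" "L v \<le> x v" using l uvU by (auto simp: L_def)
    moreover have "x u + x v \<le> 1" using tight uv .
    ultimately have "x u = L u" and "L u + L v - 1 = 0" by auto
    then have "\<forall>A\<in>\<D>. l A * (of_bool (u \<in> A) + of_bool (v \<in> A) - 1) = 0"
      using eq sum_nonneg_eq_0_iff[OF D nonneg] by simp
    then show ?thesis using \<open>x u = L u\<close> by auto
  qed
  have zero: "l A = 0" if "A \<in> \<D> - core U \<D>" for A
    using that pair by (auto simp: core_def)
  have core: "core U \<D> \<subseteq> \<D>" by (auto simp: core_def)
  show ?thesis
  proof (intro exI[of _ l] conjI ballI)
    show "0 \<le> l A" if "A \<in> core U \<D>" for A using l0 core that by blast
    show "sum l (core U \<D>) = 1"
      using sum.mono_neutral_left[OF D core, of l] zero l1 by simp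
    show "(\<Sum>A\<in>core U \<D>. l A * of_bool (u \<in> A)) = x u" if u: "u \<in> U" for u
    proof -
      have "(\<Sum>A\<in>core U \<D>. l A * of_bool (u \<in> A)) = L u"
        unfolding L_def using zero by (intro sum.mono_neutral_left[OF D core]) simp
      then show ?thesis using partner[OF u] pair by metis
    qed
  qed
qed

text \<open>
  As there is no common element, every cover has at least two elements. The constant vector
  with entries one half is therefore a convex combination of the core, in which the members
  containing \<open>u\<close> and those avoiding \<open>u\<close> have total weight one half each.
\<close>

lemma core_common_elements:
  assumes U: "finite U" and sub: "\<And>A. A \<in> \<D> \<Longrightarrow> A \<subseteq> U" and id: "ideal_clutter U \<D>"
    and nonempty: "\<D> \<noteq> {}" and no_common: "\<And>u. u \<in> U \<Longrightarrow> \<exists>A\<in>\<D>. u \<notin> A"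
    and partner: "\<And>u. u \<in> U \<Longrightarrow> \<exists>v\<in>U. v \<noteq> u \<and> {u, v} \<in> covers U \<D>"
    and u: "u \<in> U"
  shows "\<exists>A\<in>core U \<D>. u \<in> A" "\<exists>A\<in>core U \<D>. u \<notin> A"
proof -
  have cov: "1 \<le> (\<Sum>u\<in>B. 1 / 2 :: real)" if B: "B \<in> covers U \<D>" for B
  proof -
    have fin: "finite B" using B U by (auto simp: covers_def intro: finite_subset)
    have "B \<noteq> {}" using B nonempty by (auto simp: covers_def)
    then obtain b where b: "b \<in> B" by auto
    then obtain A where "A \<in> \<D>" "b \<notin> A" using B no_common[of b] by (auto simp: covers_def)
    then obtain b' where "b' \<in> B" "b' \<noteq> b" using B by (auto simp: covers_def)
    then have "card {b, b'} \<le> card B" using b fin by (intro card_mono) auto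
    then show ?thesis using \<open>b' \<noteq> b\<close> by simp
  qed
  obtain l where l1: "sum l (core U \<D>) = 1"
    and l: "\<And>u. u \<in> U \<Longrightarrow> (\<Sum>A\<in>core U \<D>. l A * of_bool (u \<in> A)) = (1 / 2 :: real)"
    using core_convex_combination[OF U sub id partner _ cov] by auto
  have sum: "(\<Sum>A\<in>core U \<D>. l A * of_bool (u \<in> A)) = 1 / 2" using l u .
  show "\<exists>A\<in>core U \<D>. u \<in> A"
  proof (rule ccontr)
    assume "\<not> ?thesis"
    then have "(\<Sum>A\<in>core U \<D>. l A * of_bool (u \<in> A)) = 0" by (intro sum.neutral) auto
    then show False using sum by simp
  qed
  show "\<exists>A\<in>core U \<D>. u \<notin> A"
  proof (rule ccontr)
    assume "\<not> ?thesis"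
    then have "(\<Sum>A\<in>core U \<D>. l A * of_bool (u \<in> A)) = sum l (core U \<D>)"
      by (intro sum.cong) auto
    then show False using sum l1 by simp
  qed
qed

definition incidence :: "(nat \<Rightarrow> 'v) \<Rightarrow> nat \<Rightarrow> 'v set \<Rightarrow> nat \<Rightarrow> real" where
  "incidence e n A = (\<lambda>i. of_bool (i \<in> {1..n} \<and> e i \<in> A))"

text \<open>
  It suffices to use the valid inequalities \<open>x \<ge> 0\<close>, \<open>x(B) \<ge> 1\<close> for covers \<open>B\<close>, and
  \<open>(1 - x\<^sub>u) + (1 - x\<^sub>v) \<ge> 1\<close> for two-element covers \<open>{u, v}\<close>; a point satisfying them is a convex
  combination of the core.
\<close>

lemma core_cube_ideal:
  assumes e: "bij_betw e {1..n} U"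
    and sub: "\<And>A. A \<in> \<D> \<Longrightarrow> A \<subseteq> U" and id: "ideal_clutter U \<D>"
    and partner: "\<And>u. u \<in> U \<Longrightarrow> \<exists>v\<in>U. v \<noteq> u \<and> {u, v} \<in> covers U \<D>"
  shows "cube_ideal n (incidence e n ` core U \<D>)" (is "cube_ideal n ?S")
proof (rule cube_idealI)
  show "?S \<subseteq> cube n" by (auto simp: cube_def real_space_def incidence_def)
next
  fix z
  assume z: "z \<in> real_space n"
    and valid: "\<And>q. ineq_in_dim n q \<Longrightarrow> \<forall>s\<in>?S. satisfies s q \<Longrightarrow> satisfies z q"
  have U: "finite U" using e bij_betw_finite by blast
  have eU: "e i \<in> U" if "i \<in> {1..n}" for i using e that by (auto simp: bij_betw_def)
  define x where "x u = z (the_inv_into {1..n} e u)" for u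
  have xe: "x (e i) = z i" if "i \<in> {1..n}" for i
    using e that by (simp add: x_def the_inv_into_f_f bij_betw_def)
  define I where "I B = {i\<in>{1..n}. e i \<in> B}" for B
  have bij: "bij_betw e (I B) B" if "B \<subseteq> U" for B
    using e that by (intro bij_betw_subset[OF e]) (auto simp: I_def bij_betw_def)
  have sum_I: "(\<Sum>i\<in>I B. z i) = sum x B" if "B \<subseteq> U" for B
    using sum.reindex_bij_betw[OF bij[OF that], of x] xe by (simp add: I_def)
  have dim: "I B \<subseteq> {1..n}" "finite (I B)" for B by (auto simp: I_def)
  have x0: "0 \<le> x u" if u: "u \<in> U" for u
  proof -
    obtain i where i: "i \<in> {1..n}" "u = e i" using e u by (auto simp: bij_betw_def)
    have "satisfies z (Lower i)" using i by (intro valid) (auto simp: incidence_def)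
    then show ?thesis using i xe by simp
  qed
  have x1: "1 \<le> sum x B" if B: "B \<in> covers U \<D>" for B
  proof -
    have BU: "B \<subseteq> U" using B by (auto simp: covers_def)
    have "satisfies (incidence e n A) (Gen_Cover (I B) {})" if A: "A \<in> core U \<D>" for A
    proof -
      obtain u where u: "u \<in> A" "u \<in> B" using A B by (fastforce simp: covers_def core_def)
      then have "u \<in> e ` I B" using bij_betw_imp_surj_on[OF bij[OF BU]] by simp
      then obtain i where i: "i \<in> I B" "e i = u" by blast
      have "incidence e n A i \<le> sum (incidence e n A) (I B)"
        using i dim by (intro member_le_sum) (auto simp: incidence_def)
      then show ?thesis using i u by (simp add: incidence_def I_def)
    qed
    then have "satisfies z (Gen_Cover (I B) {})" using dim by (intro valid) auto
    then show ?thesis using sum_I[OF BU] by simp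
  qed
  have x2: "x u + x v \<le> 1" if uv: "u \<noteq> v" "{u, v} \<in> covers U \<D>" for u v
  proof -
    have uvU: "{u, v} \<subseteq> U" using uv by (auto simp: covers_def)
    have card: "card (I {u, v}) = 2"
      using bij_betw_same_card[OF bij[OF uvU]] uv by simp
    have "satisfies (incidence e n A) (Gen_Cover {} (I {u, v}))" if A: "A \<in> core U \<D>" for A
    proof -
      obtain a where a: "a \<in> {u, v}" "a \<notin> A" using A uv by (auto simp: core_def)
      then have "a \<in> e ` I {u, v}" using bij_betw_imp_surj_on[OF bij[OF uvU]] by simp
      then obtain i where i: "i \<in> I {u, v}" "e i = a" by blast
      have "1 - incidence e n A i \<le> (\<Sum>i\<in>I {u, v}. 1 - incidence e n A i)"
        using i dim by (intro member_le_sum[of i _ "\<lambda>i. 1 - incidence e n A i"])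
          (auto simp: incidence_def)
      then show ?thesis using i a by (simp add: incidence_def)
    qed
    then have "satisfies z (Gen_Cover {} (I {u, v}))" using dim by (intro valid) auto
    then have "1 \<le> 2 - (\<Sum>i\<in>I {u, v}. z i)" by (simp add: sum_subtractf card)
    then show ?thesis using sum_I[OF uvU] uv by simp
  qed
  obtain l where l0: "\<And>A. A \<in> core U \<D> \<Longrightarrow> 0 \<le> l A" and l1: "sum l (core U \<D>) = 1"
    and l: "\<And>u. u \<in> U \<Longrightarrow> (\<Sum>A\<in>core U \<D>. l A * of_bool (u \<in> A)) = x u"
    using core_convex_combination[OF U sub id partner x0 x1 x2] by blast
  have "z = (\<Sum>A\<in>core U \<D>. l A *\<^sub>R incidence e n A)"
  proof
    fix i
    show "z i = (\<Sum>A\<in>core U \<D>. l A *\<^sub>R incidence e n A) i"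
    proof (cases "i \<in> {1..n}")
      case True
      then show ?thesis using l[OF eU[OF True]] xe
        by (simp add: sum_fun_apply scaleR_fun_def incidence_def)
    next
      case False
      then have "z i = 0" "incidence e n A i = 0" for A
        using z False by (auto simp: real_space_def incidence_def)
      then show ?thesis by (simp add: sum_fun_apply scaleR_fun_def)
    qed
  qed
  also have "\<dots> \<in> convex hull ?S"
  proof (rule convex_sum)
    have "core U \<D> \<subseteq> Pow U" using sub by (auto simp: core_def)
    then show "finite (core U \<D>)" using U by (simp add: finite_subset)
    show "incidence e n A \<in> convex hull ?S" if "A \<in> core U \<D>" for A
      using that by (intro hull_inc imageI)
  qed (use l0 l1 in simp_all)
  finally show "z \<in> convex hull ?S" .
qed

section \<open>Cube-ideal sets and intersecting clutters\<close>

theorem theorem23: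
  fixes k :: nat
  assumes "k \<ge> 4"
  shows "(\<forall>n\<ge>1. \<forall>S. S \<subseteq> cube n \<and> cube_ideal n S \<longrightarrow>
            agree_on_coordinate n S \<or>
            (\<exists>T\<subseteq>S. finite T \<and> card T \<le> k \<and> \<not> agree_on_coordinate n T))
         \<longleftrightarrow>
         (\<forall>(V :: 'v::infinite set) \<C>. clutter V \<C> \<and> k_wise_intersecting k V \<C> \<longrightarrow>
            \<not> ideal_clutter V \<C>)"
    (is "?cubes \<longleftrightarrow> ?clutters")
proof
  assume cubes: ?cubes
  show ?clutters
  proof (intro allI impI notI)
    fix V :: "'v set" and \<C>
    assume "clutter V \<C> \<and> k_wise_intersecting k V \<C>" and id: "ideal_clutter V \<C>"
    then have V: "finite V" and sub: "\<And>A. A \<in> \<C> \<Longrightarrow> A \<subseteq> V"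
      and meet: "\<And>\<D>. \<D> \<subseteq> \<C> \<Longrightarrow> finite \<D> \<Longrightarrow> card \<D> \<le> k \<Longrightarrow> \<exists>v\<in>V. \<forall>A\<in>\<D>. v \<in> A"
      and no_common: "\<And>v. v \<in> V \<Longrightarrow> \<exists>A\<in>\<C>. v \<notin> A"
      by (auto simp: clutter_def k_wise_intersecting_def)
    obtain U where U: "U \<subseteq> V"
      and noU: "\<And>v. v \<in> V \<Longrightarrow> \<exists>A\<in>{A\<in>\<C>. A \<subseteq> U}. v \<notin> A"
      and partner: "\<And>u. u \<in> U \<Longrightarrow> \<exists>v\<in>U. v \<noteq> u \<and> {u, v} \<in> covers U {A\<in>\<C>. A \<subseteq> U}"
      using deletion_with_two_covers[OF V no_common sub] by blast
    define \<D> where "\<D> = {A\<in>\<C>. A \<subseteq> U}"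
    note noU = noU[folded \<D>_def] and partner = partner[folded \<D>_def]
    have finU: "finite U" using U V by (rule finite_subset)
    have subU: "A \<subseteq> U" if "A \<in> \<D>" for A using that by (simp add: \<D>_def)
    have idU: "ideal_clutter U \<D>"
      unfolding \<D>_def using V sub id U by (rule ideal_clutter_deletion)
    obtain v\<^sub>0 where v\<^sub>0: "v\<^sub>0 \<in> V" using meet[of "{}"] by auto
    then obtain A\<^sub>0 where A\<^sub>0: "A\<^sub>0 \<in> \<D>" using noU by blast
    then have D_ne: "\<D> \<noteq> {}" by auto
    have "A\<^sub>0 \<noteq> {}" using meet[of "{A\<^sub>0}"] A\<^sub>0 assms by (auto simp: \<D>_def)
    then have "U \<noteq> {}" using subU A\<^sub>0 by blast
    define n where "n = card U"
    have n: "1 \<le> n" using \<open>U \<noteq> {}\<close> finU by (simp add: n_def Suc_le_eq card_gt_0_iff)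
    obtain e where e: "bij_betw e {1..n} U"
      using ex_bij_betw_nat_finite_1[OF finU] unfolding n_def by blast
    have eU: "e i \<in> U" if "i \<in> {1..n}" for i using e that by (auto simp: bij_betw_def)
    define S where "S = incidence e n ` core U \<D>"
    have coreD: "core U \<D> \<subseteq> \<D>" by (auto simp: core_def)
    have ideal: "cube_ideal n S"
      unfolding S_def using e subU idU partner by (rule core_cube_ideal)
    have "\<not> agree_on_coordinate n S"
    proof
      assume "agree_on_coordinate n S"
      then obtain i a where i: "i \<in> {1..n}"
        and a: "\<And>A. A \<in> core U \<D> \<Longrightarrow> incidence e n A i = a"
        unfolding agree_on_coordinate_def S_def by blast
      obtain A A' where "A \<in> core U \<D>" "e i \<in> A" "A' \<in> core U \<D>" "e i \<notin> A'"
        using core_common_elements[OF finU subU idU D_ne noU[OF subsetD[OF U]] partner eU[OF i]]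
        by blast
      then show False using a[of A] a[of A'] i by (simp add: incidence_def)
    qed
    moreover have "agree_on_coordinate n T" if T: "T \<subseteq> S" "finite T" "card T \<le> k" for T
    proof -
      obtain \<E> where E: "\<E> \<subseteq> core U \<D>" "T = incidence e n ` \<E>" and inj: "inj_on (incidence e n) \<E>"
        using T(1) unfolding S_def subset_image_inj by blast
      have "finite \<E>" "card \<E> \<le> k"
        using T E inj finite_imageD by (auto simp: card_image)
      moreover have "\<E> \<subseteq> \<C>" using E coreD by (auto simp: \<D>_def)
      ultimately obtain v where v: "\<And>A. A \<in> \<E> \<Longrightarrow> v \<in> A" using meet by blast
      show ?thesis
      proof (cases "\<E> = {}")
        case True
        then show ?thesis using E n by (auto simp: agree_on_coordinate_def)
      next
        case False
        then obtain A where "A \<in> \<E>" by auto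
        then have "v \<in> U" using v E coreD subU by blast
        then obtain i where "i \<in> {1..n}" "e i = v" using e by (auto simp: bij_betw_def)
        then show ?thesis using v E
          by (auto simp: agree_on_coordinate_def incidence_def intro!: bexI[of _ i])
      qed
    qed
    moreover have "S \<subseteq> cube n" using ideal by (simp add: cube_ideal_def)
    ultimately show False using cubes[rule_format, OF n, of S] ideal by auto
  qed
next
  assume clutters: ?clutters
  show ?cubes
  proof (intro allI impI)
    fix n :: nat and S
    assume n: "1 \<le> n" and "S \<subseteq> cube n \<and> cube_ideal n S"
    then have cube: "S \<subseteq> cube n" and id: "cube_ideal n S" by simp_all
    obtain g :: "nat \<Rightarrow> 'v" where g: "inj g"
      using arb_countable_map[of "{}"] by auto
    define f where "f i b = g (2 * i + of_bool b)" for i b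
    have f: "f i b = f j c \<longleftrightarrow> i = j \<and> b = c" for i j b c
    proof -
      have "f i b = f j c \<longleftrightarrow> 2 * i + of_bool b = 2 * j + (of_bool c :: nat)"
        using g by (simp add: f_def inj_eq)
      also have "\<dots> \<longleftrightarrow> i = j \<and> b = c" by (cases b; cases c) (simp_all, presburger+)
      finally show ?thesis .
    qed
    interpret cube_embedding f n S using f cube by unfold_locales auto
    show "agree_on_coordinate n S \<or>
        (\<exists>T\<subseteq>S. finite T \<and> card T \<le> k \<and> \<not> agree_on_coordinate n T)"
    proof (rule ccontr)
      assume "\<not> ?thesis"
      then have disagree: "\<not> agree_on_coordinate n S"
        and agree: "\<And>T. T \<subseteq> S \<Longrightarrow> finite T \<Longrightarrow> card T \<le> k \<Longrightarrow> agree_on_coordinate n T"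
        by auto
      have "\<exists>v\<in>V. \<forall>A\<in>\<D>. v \<in> A" if D: "\<D> \<subseteq> \<C>" "finite \<D>" "card \<D> \<le> k" for \<D>
      proof -
        obtain T where T: "T \<subseteq> S" "\<D> = cuboid_member f n ` T" and inj: "inj_on (cuboid_member f n) T"
          using D(1) unfolding subset_image_inj by blast
        have "finite T" "card T \<le> k" using D T inj finite_imageD by (auto simp: card_image)
        then show ?thesis using agree T common_element_iff_agree[OF T(1)] by simp
      qed
      then have "k_wise_intersecting k V \<C>"
        using disagree common_element_iff_agree[OF order_refl]
        unfolding k_wise_intersecting_def by blast
      then show False
        using clutters[rule_format, of V \<C>] cuboid_clutter cuboid_ideal[OF n id] by simp
    qed
  qed
qed

end
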